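(* Let $\alpha,\beta$ be positive integers with $\gcd(\alpha,\beta)=1$ and $\alpha\beta=2^{\nu}\mho$, where $\nu\in\{0,1,2,3\}$ and $\mho$ is an odd squarefree positive integer with $\mho\equiv0\pmod 3$. Let $n\in\mathbb{N}$ and $(c,d)\in\Omega_3$. Then $$R_{(c,d)}(n)=12\sigma\bigl(\tfrac nc\bigr)-36\sigma\bigl(\tfrac n{3c}\bigr)+12\sigma\bigl(\tfrac nd\bigr)-36\sigma\bigl(\tfrac n{3d}\bigr)+144\,W_{(c,d)}(n)+1296\,W_{(c,d)}\bigl(\tfrac n3\bigr)-432\bigl(W_{(3c,d)}(n)+W_{(c,3d)}(n)\bigr).$$
   Context: $\mathbb{N}$ is the set of positive integers, $\mathbb{N}_0=\mathbb{N}\cup\{0\}$. $\sigma(n)=\sum_{0<d\mid n}d$ for $n\in\mathbb{N}$ and $\sigma(m)=0$ for $m\notin\mathbb{N}$. For positive integers $r,s$, $W_{(r,s)}(n)=\sum_{(l,m)\in\mathbb{N}_0^2,\ rl+sm=n}\sigma(l)\sigma(m)$, which is $0$ if there is no such representation of $n$ with $(l,m)\in\mathbb{N}^2$ (in particular if $n$ is not an integer). $R_{(c,d)}(n)$ is the number of $(x_1,\dots,x_8)\in\mathbb{Z}^8$ with $n=c(x_1^2+x_1x_2+x_2^2+x_3^2+x_3x_4+x_4^2)+d(x_5^2+x_5x_6+x_6^2+x_7^2+x_7x_8+x_8^2)$. Definition of $\Omega_3$ (for given $\alpha\beta=2^\nu\mho$): let $\Delta=\alpha\beta/3=2^\nu\mho/3$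 and $P_3=\{2^{\nu}\}\cup\{p: p\text{ is a prime divisor of }\mho,\ p\neq3\}$. For a subset $Q\subseteq P_3$ put $\mu(Q)=\prod_{p\in Q}p$, with $\mu(\emptyset)=1$. Then $\Omega_3$ is the set of pairs $(\mu(Q_1),\mu(Q_2))$ with $Q_1,Q_2\subseteq P_3$, $\gcd(\mu(Q_1),\mu(Q_2))=1$ and $\mu(Q_1)\mu(Q_2)=\Delta$. *)

theory Defs
  imports Complex_Main "HOL-Computational_Algebra.Computational_Algebra"
begin

text \<open>The argument is rational because \<open>\<sigma>\<close> is evaluated at quotients such as \<open>n / c\<close>; it vanishes
  at every argument that is not a positive integer. On a positive integer the floor is the
  identity.\<close>

definition sigma :: "rat \<Rightarrow> nat" where
  "sigma x = (if x \<in> \<nat> \<and> x > 0 then \<Sum>d | d dvd nat \<lfloor>x\<rfloor>. d else 0)"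

text \<open>For positive \<open>r\<close> and \<open>s\<close> the index set is finite, so that the sum is the intended one.
  The indices \<open>l\<close> and \<open>m\<close> range over the natural numbers including 0, where \<open>sigma\<close> vanishes.\<close>

definition W :: "nat \<Rightarrow> nat \<Rightarrow> rat \<Rightarrow> nat" where
  "W r s x = (\<Sum>(l, m) \<in> {(l :: nat, m :: nat). of_nat (r * l + s * m) = x}.
                sigma (of_nat l) * sigma (of_nat m))"

text \<open>For positive \<open>c\<close> and \<open>d\<close> the form is positive definite, so the set counted is finite.\<close>

definition R :: "nat \<Rightarrow> nat \<Rightarrow> nat \<Rightarrow> nat" where
  "R c d n = card {(x1 :: int, x2 :: int, x3 :: int, x4 :: int,
                    x5 :: int, x6 :: int, x7 :: int, x8 :: int).
     int n = int c * (x1^2 + x1 * x2 + x2^2 + x3^2 + x3 * x4 + x4^2)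
           + int d * (x5^2 + x5 * x6 + x6^2 + x7^2 + x7 * x8 + x8^2)}"

definition P3 :: "nat \<Rightarrow> nat \<Rightarrow> nat set" where
  "P3 \<nu> mho = {2 ^ \<nu>} \<union> {p. prime p \<and> p dvd mho \<and> p \<noteq> 3}"

definition mu :: "nat set \<Rightarrow> nat" where
  "mu Q = (\<Prod>p\<in>Q. p)"

text \<open>\<open>\<Omega>\<^sub>3\<close> is only used when 3 divides \<open>mho\<close>, so that the division below is exact.\<close>

definition Omega3 :: "nat \<Rightarrow> nat \<Rightarrow> (nat \<times> nat) set" where
  "Omega3 \<nu> mho = {(mu Q1, mu Q2) | Q1 Q2.
     Q1 \<subseteq> P3 \<nu> mho \<and> Q2 \<subseteq> P3 \<nu> mho \<and>
     gcd (mu Q1) (mu Q2) = 1 \<and> mu Q1 * mu Q2 = (2 ^ \<nu> * mho) div 3}"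

end

theory Submission
  imports Defs "HOL-Number_Theory.Residue_Primitive_Roots" "HOL-Library.Discrete_Functions"
begin

text \<open>The octonary form is \<open>c Q(z) + d Q(w)\<close> for one quaternary form \<open>Q\<close>, so \<open>R c d n\<close> is the
  sum of \<open>r\<^sub>4 l * r\<^sub>4 m\<close> over the splittings \<open>c l + d m = n\<close>, where \<open>r\<^sub>4\<close> counts the
  representations by \<open>Q\<close>. Everything rests on
  \<open>r\<^sub>4 n = 12 \<sigma>(n) - 36 \<sigma>(n/3)\<close> for positive \<open>n\<close> (\<open>card_reps_quaternary_form\<close>), with
  \<open>r\<^sub>4 0 = 1\<close>. Substituting this and expanding the product, the terms with \<open>l = 0\<close> or \<open>m = 0\<close>
  give the divisor sums at \<open>n/c\<close>, \<open>n/(3c)\<close>, \<open>n/d\<close> and \<open>n/(3d)\<close>, and the four products of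
  \<open>\<sigma>(l)\<close>, \<open>\<sigma>(l/3)\<close> with \<open>\<sigma>(m)\<close>, \<open>\<sigma>(m/3)\<close> give the four convolution sums
  (\<open>R_formula\<close>).

  The quaternary form is itself a sum of two copies of \<open>x\<^sup>2 + x y + y\<^sup>2\<close>, the norm form of the
  Eisenstein integers. Its representation numbers are \<open>6 g(n)\<close>, where \<open>g(n)\<close> is the sum of the
  nontrivial character \<open>chi3\<close> modulo 3 over the divisors of \<open>n\<close>
  (\<open>card_eis_points\<close>). Instead of unique factorisation, the proof compares two recursions: for
  every prime \<open>p\<close>, both sides satisfy
  \<open>f(p n) = (1 + chi3 p) f(n) - chi3 p f(n/p)\<close>, and this determines \<open>f\<close> from \<open>f(1)\<close>.
  For the number of points the three values of \<open>chi3 p\<close> correspond to \<open>p\<close> being split, inert or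
  ramified.

  There remains the convolution of \<open>g\<close> with itself, a sum of \<open>chi3 a * chi3 b\<close> over all
  \<open>a x + b y = n\<close>. Since \<open>chi3 k\<close> is proportional to \<open>sin (2 \<pi> k / 3)\<close>, this product is a
  difference \<open>F(a - b) - F(a + b)\<close> with \<open>F\<close> an even function, namely a multiple of
  \<open>cos (2 \<pi> k / 3)\<close>. Liouville's identity (\<open>liouville_identity\<close>) evaluates such sums as divisor
  sums.\<close>

section \<open>The divisor sum and the character modulo 3\<close>

lemma sigma_0 [simp]: "sigma 0 = 0"
  by (simp add: sigma_def)

lemma sigma_of_nat: "n > 0 \<Longrightarrow> sigma (of_nat n) = (\<Sum>d | d dvd n. d)"
  by (simp add: sigma_def)

lemma sigma_divide:
  assumes "k > 0"
  shows "sigma (of_nat n / of_nat k) = (if k dvd n then sigma (of_nat (n div k)) else 0)"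
proof (cases "k dvd n")
  case True
  then obtain m where "n = k * m" by (elim dvdE)
  with assms show ?thesis by simp
next
  case False
  have "(of_nat n / of_nat k :: rat) \<notin> \<nat>"
  proof
    assume "(of_nat n / of_nat k :: rat) \<in> \<nat>"
    then obtain m where "(of_nat n / of_nat k :: rat) = of_nat m" by (auto elim: Nats_cases)
    then have "(of_nat n :: rat) = of_nat (m * k)" using assms by (simp add: field_simps)
    then have "n = m * k" by (simp only: of_nat_eq_iff)
    with False show False by simp
  qed
  with False show ?thesis by (simp add: sigma_def)
qed

definition chi3 :: "nat \<Rightarrow> int" where
  "chi3 d = (if d mod 3 = 1 then 1 else if d mod 3 = 2 then - 1 else 0)"

lemma chi3_mult: "chi3 (a * b) = chi3 a * chi3 b"
proof -
  have "a mod 3 < 3" "b mod 3 < 3" by auto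
  then have "a mod 3 \<in> {0, 1, 2}" "b mod 3 \<in> {0, 1, 2}" by auto
  moreover have "(a * b) mod 3 = ((a mod 3) * (b mod 3)) mod 3" by (simp add: mod_mult_eq)
  ultimately show ?thesis by (auto simp: chi3_def)
qed

section \<open>The binary form\<close>

text \<open>The norm of \<open>x + y \<zeta>\<close> for a primitive sixth root of unity \<open>\<zeta>\<close>. This generator gives
  the sign \<open>+ x y\<close>; a cube root of unity would give \<open>- x y\<close>.\<close>

definition eis_norm :: "int \<Rightarrow> int \<Rightarrow> int" where
  "eis_norm x y = x^2 + x * y + y^2"

definition eis_points :: "nat \<Rightarrow> (int \<times> int) set" where
  "eis_points n = {(x, y). eis_norm x y = int n}"

text \<open>Multiplication by \<open>u + v \<zeta>\<close>, computed with \<open>\<zeta>\<^sup>2 = \<zeta> - 1\<close>. The conjugate of \<open>u + v \<zeta>\<close> is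
  \<open>(u + v) - v \<zeta>\<close>.\<close>

definition eis_mult :: "int \<Rightarrow> int \<Rightarrow> int \<times> int \<Rightarrow> int \<times> int" where
  "eis_mult u v = (\<lambda>(x, y). (u * x - v * y, u * y + v * x + v * y))"

lemma eis_norm_mult:
  "eis_norm (u * x - v * y) (u * y + v * x + v * y) = eis_norm u v * eis_norm x y"
  by (simp add: eis_norm_def power2_eq_square algebra_simps)

lemma eis_norm_conj: "eis_norm (u + v) (- v) = eis_norm u v"
  by (simp add: eis_norm_def power2_eq_square algebra_simps)

lemma eis_mult_conj:
  "eis_mult (u + v) (- v) (eis_mult u v (x, y)) = (eis_norm u v * x, eis_norm u v * y)"
  by (simp add: eis_mult_def eis_norm_def power2_eq_square algebra_simps)

lemma eis_norm_sum_squares: "4 * eis_norm x y = (2 * x + y)^2 + 3 * y^2"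
  by (simp add: eis_norm_def power2_eq_square algebra_simps)

lemma eis_norm_nonneg: "eis_norm x y \<ge> 0"
  using eis_norm_sum_squares[of x y] zero_le_power2[of "2 * x + y"] zero_le_power2[of y] by linarith

lemma eis_norm_commute: "eis_norm x y = eis_norm y x"
  by (simp add: eis_norm_def power2_eq_square algebra_simps)

lemma square_le_eis_norm: "3 * y^2 \<le> 4 * eis_norm x y" "3 * x^2 \<le> 4 * eis_norm x y"
  using eis_norm_sum_squares[of x y] zero_le_power2[of "2 * x + y"]
    eis_norm_sum_squares[of y x] zero_le_power2[of "2 * y + x"] eis_norm_commute[of x y]
  by linarith+

lemma eis_norm_eq_0_iff: "eis_norm x y = 0 \<longleftrightarrow> x = 0 \<and> y = 0"
proof
  assume "eis_norm x y = 0"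
  then have "y^2 \<le> 0" "x^2 \<le> 0" using square_le_eis_norm[where x = x and y = y] by linarith+
  then show "x = 0 \<and> y = 0" by simp
qed (simp add: eis_norm_def)

lemma finite_eis_points [simp]: "finite (eis_points n)"
proof (rule finite_subset)
  have le: "\<bar>z\<bar> \<le> z^2" for z :: int
  proof (cases "z = 0")
    case False
    then have "\<bar>z\<bar> * 1 \<le> \<bar>z\<bar> * \<bar>z\<bar>" by (intro mult_left_mono) auto
    then show ?thesis by (simp add: power2_eq_square flip: abs_mult)
  qed simp
  show "eis_points n \<subseteq> {- 2 * int n..2 * int n} \<times> {- 2 * int n..2 * int n}"
  proof (clarsimp simp: eis_points_def)
    fix x y assume "eis_norm x y = int n"
    then show "- (2 * int n) \<le> x \<and> x \<le> 2 * int n \<and> - (2 * int n) \<le> y \<and> y \<le> 2 * int n"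
      using square_le_eis_norm[where x = x and y = y] le[of x] le[of y] by linarith
  qed
qed simp

lemma inj_eis_mult:
  assumes "eis_norm u v \<noteq> 0"
  shows "inj (eis_mult u v)"
proof (rule injI)
  fix z w assume "eis_mult u v z = eis_mult u v w"
  then have "eis_mult (u + v) (- v) (eis_mult u v z) = eis_mult (u + v) (- v) (eis_mult u v w)"
    by simp
  with assms show "z = w" by (cases z; cases w) (simp add: eis_mult_conj)
qed

text \<open>A point of norm \<open>p n\<close> is a multiple of \<open>\<pi> = u + v \<zeta>\<close> iff \<open>p\<close> divides both coordinates of its
  product with the conjugate of \<open>\<pi>\<close>. That product has norm divisible by \<open>p\<close>, so it is enough
  to test the second coordinate \<open>u y - v x\<close>.\<close>

lemma eis_mult_image:
  assumes p: "prime p" and uv: "eis_norm u v = int p"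
  shows "eis_mult u v ` eis_points n = {(x, y) \<in> eis_points (p * n). int p dvd u * y - v * x}"
proof (intro equalityI subsetI)
  fix z assume "z \<in> eis_mult u v ` eis_points n"
  then obtain x y where z: "z = (u * x - v * y, u * y + v * x + v * y)" and n: "eis_norm x y = int n"
    by (auto simp: eis_points_def eis_mult_def)
  have "u * (u * y + v * x + v * y) - v * (u * x - v * y) = int p * y"
    unfolding uv[symmetric] eis_norm_def by (simp add: power2_eq_square power3_eq_cube algebra_simps)
  then have "int p dvd u * (u * y + v * x + v * y) - v * (u * x - v * y)" by simp
  then show "z \<in> {(x, y) \<in> eis_points (p * n). int p dvd u * y - v * x}"
    by (simp add: z eis_points_def eis_norm_mult n uv)
next
  fix z assume "z \<in> {(x, y) \<in> eis_points (p * n). int p dvd u * y - v * x}"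
  then obtain x y where z: "z = (x, y)" and xy: "eis_norm x y = int p * int n"
    and dvd: "int p dvd u * y - v * x"
    by (auto simp: eis_points_def)
  have p0: "int p \<noteq> 0" using p by auto
  have pp: "prime (int p)" using p by simp
  \<comment> \<open>the coordinates of the product of \<open>x + y \<zeta>\<close> with the conjugate of \<open>u + v \<zeta>\<close>\<close>
  define A where "A = (u + v) * x + v * y"
  define B where "B = u * y - v * x"
  have "eis_norm A B = eis_norm u v * eis_norm x y"
    unfolding A_def B_def eis_norm_def by (simp add: power2_eq_square power3_eq_cube algebra_simps)
  then have "A^2 + A * B + B^2 = int p * (int p * int n)"
    unfolding uv xy eis_norm_def[of A B] .
  then have "A^2 = int p * (int p * int n) - B * (A + B)"
    by (simp add: power2_eq_square algebra_simps)
  then have "int p dvd A^2" using dvd by (simp add: B_def)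
  then have "int p dvd A" using pp prime_dvd_power by blast
  then obtain a where a: "A = int p * a" by (elim dvdE)
  obtain b where b: "B = int p * b" using dvd unfolding B_def by (elim dvdE)
  have "int p * (u * a - v * b) = u * A - v * B" "int p * (u * b + v * a + v * b) = u * B + v * A + v * B"
    by (simp_all add: a b algebra_simps)
  moreover have "u * A - v * B = int p * x"
    unfolding A_def B_def uv[symmetric] eis_norm_def by (simp add: power2_eq_square power3_eq_cube algebra_simps)
  moreover have "u * B + v * A + v * B = int p * y"
    unfolding A_def B_def uv[symmetric] eis_norm_def by (simp add: power2_eq_square power3_eq_cube algebra_simps)
  ultimately have z': "x = u * a - v * b" "y = u * b + v * a + v * b" using p0 by simp_all
  have "eis_norm a b = int n"
    using xy p0 unfolding z' eis_norm_mult uv by simp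
  then show "z \<in> eis_mult u v ` eis_points n"
    by (auto simp: z z' eis_mult_def eis_points_def intro!: image_eqI[where x = "(a, b)"])
qed

lemma card_eis_mult_image:
  assumes "prime p" and "eis_norm u v = int p"
  shows "card {(x, y) \<in> eis_points (p * n). int p dvd u * y - v * x} = card (eis_points n)"
proof -
  have "inj (eis_mult u v)" using assms by (intro inj_eis_mult) auto
  then show ?thesis
    unfolding eis_mult_image[OF assms, symmetric] by (intro card_image) (auto intro: inj_on_subset)
qed

lemma card_eis_points_divisible:
  assumes "prime p"
  shows "card {(x, y) \<in> eis_points (p * n). int p dvd x \<and> int p dvd y} =
    (if p dvd n then card (eis_points (n div p)) else 0)"
proof -
  have p0: "int p \<noteq> 0" "p \<noteq> 0" using assms by auto
  have scale: "eis_norm (int p * a) (int p * b) = int p * (int p * eis_norm a b)" for a b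
    by (simp add: eis_norm_def power2_eq_square algebra_simps)
  show ?thesis
  proof (cases "p dvd n")
    case True
    then obtain m where m: "n = p * m" by (elim dvdE)
    have "{(x, y) \<in> eis_points (p * n). int p dvd x \<and> int p dvd y} =
       (\<lambda>(a, b). (int p * a, int p * b)) ` eis_points m"
      using p0 by (force simp: eis_points_def m scale elim!: dvdE)
    moreover have "inj (\<lambda>(a, b). (int p * a, int p * b))" using p0 by (auto intro!: injI)
    ultimately show ?thesis using p0
      by (simp add: m card_image inj_on_subset)
  next
    case False
    have "eis_norm (int p * a) (int p * b) \<noteq> int (p * n)" for a b
    proof
      assume "eis_norm (int p * a) (int p * b) = int (p * n)"
      then have "int p * eis_norm a b = int n" using p0 by (simp add: scale)
      then have "int p dvd int n" by (metis dvd_triv_left)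
      with False show False by simp
    qed
    then have "{(x, y) \<in> eis_points (p * n). int p dvd x \<and> int p dvd y} = {}"
      by (auto simp: eis_points_def elim!: dvdE)
    then show ?thesis using False by (metis card.empty)
  qed
qed

text \<open>The multiplicative group modulo \<open>p\<close> is cyclic of order divisible by 3, hence it has an element
  \<open>t\<close> of order 3, and \<open>t - 1\<close> is invertible.\<close>

lemma prime_cube_root_of_unity:
  assumes p: "prime p" and "p mod 3 = 1"
  obtains t :: int where "int p dvd t^2 + t + 1"
proof -
  obtain g where "residue_primroot p g" using prime_primitive_root_exists[OF prime_gt_1_nat[OF p] p] by auto
  then have g: "ord p g = p - 1" "coprime p g"
    using p by (auto simp: residue_primroot_def totient_prime)
  define k where "k = (p - 1) div 3"
  have "p \<ge> 2" using p prime_ge_2_nat by auto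
  then have k: "p - 1 = 3 * k" "0 < k" "k < p - 1" using assms(2) unfolding k_def by presburger+
  define t where "t = int (g ^ k)"
  have "[g ^ (3 * k) = 1] (mod p)" using ord_works[of g p] g k by simp
  then have "[int (g ^ (3 * k)) = int 1] (mod int p)" by (simp only: cong_int_iff)
  then have "int p dvd t^3 - 1"
    by (simp add: cong_iff_dvd_diff t_def power_mult[symmetric] mult.commute)
  also have "t^3 - 1 = (t - 1) * (t^2 + t + 1)" by (simp add: power2_eq_square power3_eq_cube algebra_simps)
  finally have "int p dvd t - 1 \<or> int p dvd t^2 + t + 1"
    using p by (simp add: prime_dvd_mult_iff)
  moreover have "\<not> int p dvd t - 1"
  proof
    assume "int p dvd t - 1"
    then have "[int (g ^ k) = int 1] (mod int p)" by (simp add: cong_iff_dvd_diff t_def)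
    then have "[g ^ k = 1] (mod p)" by (simp only: cong_int_iff)
    then have "p - 1 dvd k" using g by (metis ord_divides)
    with k show False by (auto dest: dvd_imp_le)
  qed
  ultimately show ?thesis using that by blast
qed

text \<open>Thue's lemma: with \<open>k\<close> the integer part of the square root of \<open>p\<close>, there are more than \<open>p\<close> pairs
  \<open>(i, j)\<close> with entries in \<open>{0..k}\<close>, so two of them have the same value \<open>i - t j\<close> modulo \<open>p\<close>;
  their difference is the required pair.\<close>

lemma thue:
  fixes t :: int
  assumes p: "prime p"
  obtains u v :: int where "int p dvd u - t * v" "u^2 < int p" "v^2 < int p" "u \<noteq> 0 \<or> v \<noteq> 0"
proof -
  define k where "k = floor_sqrt p"
  have "k^2 \<noteq> p"
    using p prime_power_iff[of k 2] by auto
  then have k: "k^2 < p" "p < (Suc k)^2"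
    using floor_sqrt_power2_le[of p] Suc_floor_sqrt_power2_gt[of p] by (auto simp: k_def order_less_le)
  define f where "f = (\<lambda>(i, j). (int i - t * int j) mod int p)"
  have "f ` ({..k} \<times> {..k}) \<subseteq> {0..<int p}" using prime_gt_0_nat[OF p] by (auto simp: f_def)
  then have "card (f ` ({..k} \<times> {..k})) \<le> p" using card_mono[of "{0..<int p}"] by fastforce
  also have "p < card ({..k} \<times> {..k})" using k by (simp add: power2_eq_square)
  finally have "\<not> inj_on f ({..k} \<times> {..k})" using card_image by force
  then obtain i j i' j' where ij: "i \<le> k" "j \<le> k" "i' \<le> k" "j' \<le> k" "(i, j) \<noteq> (i', j')"
    and f: "f (i, j) = f (i', j')" by (auto simp: inj_on_def)
  have small: "(int a - int b)^2 < int p" if "a \<le> k" "b \<le> k" for a b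
  proof -
    have "\<bar>int a - int b\<bar> \<le> \<bar>int k\<bar>" using that by linarith
    then have "(int a - int b)^2 \<le> (int k)^2" by (simp only: abs_le_square_iff)
    also have "\<dots> < int p" using k(1) by (metis of_nat_less_iff of_nat_power)
    finally show ?thesis .
  qed
  show ?thesis
  proof (rule that)
    show "int p dvd (int i - int i') - t * (int j - int j')"
      using f by (simp add: f_def mod_eq_dvd_iff algebra_simps)
    show "int i - int i' \<noteq> 0 \<or> int j - int j' \<noteq> 0" using ij(5) by auto
  qed (use small ij in auto)
qed

text \<open>For a cube root of unity \<open>t\<close> modulo \<open>p\<close>, a small pair \<open>u \<equiv> t v\<close> has a positive norm that is
  divisible by \<open>p\<close> and less than \<open>3 p\<close>. The value \<open>2 p\<close> is impossible, because an even norm is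
  divisible by 4.\<close>

lemma prime_eq_eis_norm:
  assumes p: "prime p" and p3: "p mod 3 = 1"
  obtains u v where "eis_norm u v = int p"
proof -
  obtain t where t: "int p dvd t^2 + t + 1" using prime_cube_root_of_unity[OF assms] .
  obtain u v where uv: "int p dvd u - t * v" "u^2 < int p" "v^2 < int p" "u \<noteq> 0 \<or> v \<noteq> 0"
    using thue[OF p] .
  have "eis_norm u v = (u - t * v) * (u + t * v + v) + v^2 * (t^2 + t + 1)"
    by (simp add: eis_norm_def power2_eq_square algebra_simps)
  then have "int p dvd eis_norm u v" using uv(1) t by simp
  then obtain m where m: "eis_norm u v = int p * m" by (elim dvdE)
  have "0 \<le> (u - v)^2" by simp
  then have "2 * eis_norm u v \<le> 3 * (u^2 + v^2)"
    unfolding eis_norm_def by (simp add: power2_diff algebra_simps)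
  then have "eis_norm u v < 3 * int p" using uv(2,3) unfolding distrib_left by linarith
  then have "int p * m < int p * 3" using m by simp
  then have "m < 3" using p prime_gt_0_nat by (simp add: mult_less_cancel_left)
  moreover have "eis_norm u v > 0"
    using eis_norm_nonneg[of u v] eis_norm_eq_0_iff[of u v] uv(4) by linarith
  then have "m > 0" using m p prime_gt_0_nat by (simp add: zero_less_mult_iff)
  moreover have "m \<noteq> 2"
  proof
    assume "m = 2"
    then have "even (eis_norm u v)" using m by simp
    then have "even u" "even v" by (auto simp: eis_norm_def)
    then obtain a b where "u = 2 * a" "v = 2 * b" by (elim evenE)
    then have "2 * (eis_norm a b) = int p"
      using m \<open>m = 2\<close> by (simp add: eis_norm_def algebra_simps power2_eq_square)
    then have "even (int p)" by (metis dvd_triv_left)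
    then have "p = 2" using p primes_dvd_imp_eq[of 2 p] by simp
    with p3 show False by simp
  qed
  ultimately have "m = 1" by linarith
  with m that show ?thesis by simp
qed

text \<open>Let \<open>\<pi>\<close> have norm \<open>p\<close>. Every point of norm \<open>p n\<close> is a multiple of \<open>\<pi>\<close> or of its conjugate, and
  the two classes meet in the multiples of \<open>p\<close>, so the recursion is inclusion-exclusion.\<close>

lemma card_eis_points_split:
  assumes p: "prime p" and p3: "p mod 3 = 1"
  shows "int (card (eis_points (p * n))) =
     2 * int (card (eis_points n)) - (if p dvd n then int (card (eis_points (n div p))) else 0)"
proof -
  obtain u v where uv: "eis_norm u v = int p" using prime_eq_eis_norm[OF assms] .
  have pp: "prime (int p)" using p by simp
  have p2: "p \<noteq> 3" using p3 by auto
  have "\<not> p dvd 3" using p p2 primes_dvd_imp_eq[of p 3] by auto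
  then have "\<not> int p dvd 3" by (metis of_nat_dvd_iff of_nat_numeral)
  have v: "\<not> int p dvd v"
  proof
    assume v: "int p dvd v"
    have "u^2 = int p - v * (u + v)" using uv unfolding eis_norm_def by (simp add: power2_eq_square algebra_simps)
    then have "int p dvd u^2" using v by simp
    then have "int p dvd u" using pp prime_dvd_power by blast
    with v obtain a b where "u = int p * a" "v = int p * b" by (elim dvdE)
    then have "int p * (int p * eis_norm a b) = int p * 1"
      using uv by (simp add: eis_norm_def power2_eq_square algebra_simps)
    then have "int p * eis_norm a b = 1" using p by simp
    then have "int p dvd 1" by (metis dvd_triv_left)
    with pp show False by auto
  qed
  have w: "\<not> int p dvd 2 * u + v"
  proof
    assume "int p dvd 2 * u + v"
    moreover have "3 * (v * v) = 4 * int p - (2 * u + v) * (2 * u + v)"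
      unfolding uv[symmetric] eis_norm_def by (simp add: power2_eq_square power3_eq_cube algebra_simps)
    ultimately have "int p dvd 3 * (v * v)" by simp
    with v \<open>\<not> int p dvd 3\<close> pp show False by (simp add: prime_dvd_mult_iff)
  qed
  \<comment> \<open>the multiples of \<open>u + v \<zeta>\<close> and of its conjugate\<close>
  define L where "L = {(x, y) \<in> eis_points (p * n). int p dvd u * y - v * x}"
  define L' where "L' = {(x, y) \<in> eis_points (p * n). int p dvd (u + v) * y - (- v) * x}"
  have fin: "finite L" "finite L'"
    by (rule finite_subset[of _ "eis_points (p * n)"]; auto simp: L_def L'_def)+
  have cL: "card L = card (eis_points n)" "card L' = card (eis_points n)"
    unfolding L_def L'_def by (intro card_eis_mult_image p uv trans[OF eis_norm_conj uv])+
  have un: "L \<union> L' = eis_points (p * n)"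
  proof (intro equalityI subsetI)
    fix z assume "z \<in> eis_points (p * n)"
    moreover obtain x y where "z = (x, y)" by fastforce
    ultimately have z: "z = (x, y)" "(x, y) \<in> eis_points (p * n)" "eis_norm x y = int p * int n"
      by (auto simp: eis_points_def)
    have "(u * y - v * x) * ((u + v) * y - (- v) * x) = y^2 * eis_norm u v - v^2 * eis_norm x y"
      by (simp add: eis_norm_def power2_eq_square algebra_simps)
    then have "int p dvd (u * y - v * x) * ((u + v) * y - (- v) * x)" by (simp add: z uv)
    then show "z \<in> L \<union> L'" using z pp by (auto simp: L_def L'_def prime_dvd_mult_iff)
  qed (auto simp: L_def L'_def)
  have int: "L \<inter> L' = {(x, y) \<in> eis_points (p * n). int p dvd x \<and> int p dvd y}"
  proof -
    have "int p dvd y \<and> int p dvd x"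
      if h: "int p dvd u * y - v * x" "int p dvd (u + v) * y - (- v) * x" for x y
    proof -
      have "(2 * u + v) * y = (u * y - v * x) + ((u + v) * y - (- v) * x)" by (simp add: power2_eq_square power3_eq_cube algebra_simps)
      then have "int p dvd (2 * u + v) * y" using h by (metis dvd_add)
      then have y: "int p dvd y" using w pp by (simp add: prime_dvd_mult_iff)
      have "v * x = u * y - (u * y - v * x)" by (simp add: power2_eq_square power3_eq_cube algebra_simps)
      then have "int p dvd v * x" using h y by (metis dvd_diff dvd_mult)
      then show ?thesis using v pp y by (simp add: prime_dvd_mult_iff)
    qed
    moreover have "int p dvd u * y - v * x \<and> int p dvd (u + v) * y - (- v) * x"
      if "int p dvd x" "int p dvd y" for x y
      using that by (intro conjI dvd_diff dvd_mult)
    ultimately show ?thesis unfolding L_def L'_def by blast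
  qed
  have "card L + card L' = card (L \<union> L') + card (L \<inter> L')" by (rule card_Un_Int[OF fin])
  then show ?thesis unfolding un int card_eis_points_divisible[OF p] cL by auto
qed

lemma fermat_theorem_int:
  fixes x :: int
  assumes p: "prime p" and x: "\<not> int p dvd x"
  shows "[x ^ (p - 1) = 1] (mod int p)"
proof -
  define a where "a = nat (x mod int p)"
  have a: "int a = x mod int p" using prime_gt_0_nat[OF p] by (simp add: a_def)
  then have cong: "[x = int a] (mod int p)" by (simp add: cong_def)
  then have "\<not> p dvd a" using x by (metis cong_dvd_iff int_dvd_int_iff)
  then have "[a ^ (p - 1) = 1] (mod p)" using p by (intro fermat_theorem)
  then have "[int (a ^ (p - 1)) = int 1] (mod int p)" by (simp only: cong_int_iff)
  then show ?thesis using cong_pow[OF cong, of "p - 1"] by (auto intro: cong_trans)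
qed

text \<open>If \<open>p\<close> divides \<open>x\<^sup>2 + x y + y\<^sup>2\<close> but not \<open>x\<close>, then \<open>x\<^sup>3 \<equiv> y\<^sup>3\<close>; as \<open>p - 1\<close> is prime to 3, Fermat's
  theorem turns this into \<open>x \<equiv> y\<close>, whence \<open>p\<close> divides \<open>3 x\<^sup>2\<close>, which is impossible. So a norm is divisible by \<open>p\<close>
  only for multiples of \<open>p\<close>.\<close>

lemma card_eis_points_inert:
  assumes p: "prime p" and p3: "p mod 3 = 2"
  shows "card (eis_points (p * n)) = (if p dvd n then card (eis_points (n div p)) else 0)"
proof -
  have pp: "prime (int p)" using p by simp
  have dvd: "int p dvd x" if "int p dvd eis_norm x y" for x y
  proof -
    define k where "k = p div 3"
    have k: "p = 3 * k + 2" using p3 unfolding k_def by presburger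
    have "int p dvd (x - y) * eis_norm x y" using that by simp
    also have "(x - y) * eis_norm x y = x^3 - y^3"
      by (simp add: eis_norm_def power2_eq_square power3_eq_cube algebra_simps)
    finally have "[x^3 = y^3] (mod int p)" by (simp add: cong_iff_dvd_diff)
    then have "[(x^3)^k = (y^3)^k] (mod int p)" by (rule cong_pow)
    then have cong: "[x^(3*k) = y^(3*k)] (mod int p)" by (simp add: power_mult)
    show ?thesis
    proof (rule ccontr)
      assume x: "\<not> int p dvd x"
      have "\<not> int p dvd y"
      proof
        assume "int p dvd y"
        moreover have "x^2 = eis_norm x y - y * (x + y)" by (simp add: eis_norm_def power2_eq_square algebra_simps)
        ultimately have "int p dvd x^2" using that by simp
        with x pp prime_dvd_power show False by blast
      qed
      have "coprime x (int p)"
        using pp x by (metis coprime_commute prime_imp_coprime)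
      have "[x ^ (p - 1) = 1] (mod int p)" "[y ^ (p - 1) = 1] (mod int p)"
        using \<open>\<not> int p dvd y\<close> x fermat_theorem_int[OF p] by auto
      then have "[x * x ^ (3*k) = y * y ^ (3*k)] (mod int p)"
        using k by (simp add: cong_def)
      moreover have "[y * y ^ (3*k) = y * x ^ (3*k)] (mod int p)"
        using cong by (intro cong_mult cong_refl) (rule cong_sym)
      ultimately have "[x * x ^ (3*k) = y * x ^ (3*k)] (mod int p)" by (rule cong_trans)
      moreover have "coprime (x ^ (3*k)) (int p)" using \<open>coprime x (int p)\<close> by simp
      ultimately have "[x = y] (mod int p)" using cong_mult_rcancel by blast
      then have xy: "int p dvd x - y" by (simp add: cong_iff_dvd_diff)
      have "3 * (x * x) = eis_norm x y + (x - y) * (2 * x + y)" by (simp add: eis_norm_def power2_eq_square algebra_simps)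
      then have "int p dvd 3 * (x * x)" using that xy by simp
      then have "int p dvd 3" using x pp by (simp add: prime_dvd_mult_iff)
      then have "p dvd 3" by (metis of_nat_dvd_iff of_nat_numeral)
      then have "p = 3" using p primes_dvd_imp_eq[of p 3] by simp
      with p3 show False by simp
    qed
  qed
  have "eis_points (p * n) = {(x, y) \<in> eis_points (p * n). int p dvd x \<and> int p dvd y}"
    using dvd by (auto simp: eis_points_def) (metis dvd dvd_triv_left eis_norm_commute)+
  then show ?thesis using card_eis_points_divisible[OF p, of n] by simp
qed

text \<open>Here \<open>1 + \<zeta>\<close> has norm 3 and divides every point of norm divisible by 3, because
  \<open>x\<^sup>2 + x y + y\<^sup>2 \<equiv> (y - x)\<^sup>2\<close> modulo 3.\<close>

lemma card_eis_points_ramified: "card (eis_points (3 * n)) = card (eis_points n)"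
proof -
  have "3 dvd y - x" if "eis_norm x y = 3 * int n" for x y
  proof -
    have "(y - x)^2 = 3 * (int n - x * y)" using that by (simp add: eis_norm_def power2_eq_square algebra_simps)
    then have "3 dvd (y - x)^2" by simp
    then show ?thesis using prime_dvd_power[of "3::int"] by simp
  qed
  then have "eis_points (3 * n) = {(x, y) \<in> eis_points (3 * n). int 3 dvd 1 * y - 1 * x}"
    by (auto simp: eis_points_def)
  then show ?thesis
    using card_eis_mult_image[of 3 1 1 n] by (simp add: eis_norm_def)
qed

lemma card_eis_points_recursion:
  assumes p: "prime p"
  shows "int (card (eis_points (p * n))) = (1 + chi3 p) * int (card (eis_points n))
      - (if p dvd n then chi3 p * int (card (eis_points (n div p))) else 0)"
proof -
  consider "p mod 3 = 0" | "p mod 3 = 1" | "p mod 3 = 2" by linarith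
  then show ?thesis
  proof cases
    case 1
    then have "3 dvd p" by auto
    then have "p = 3" using p primes_dvd_imp_eq[of 3 p] by simp
    then show ?thesis by (simp add: card_eis_points_ramified chi3_def)
  next
    case 2
    then show ?thesis using card_eis_points_split[OF p] by (simp add: chi3_def)
  next
    case 3
    then show ?thesis using card_eis_points_inert[OF p] by (simp add: chi3_def)
  qed
qed

text \<open>The divisors of \<open>p n\<close> are the divisors of \<open>n\<close> together with their multiples by \<open>p\<close>; the overlap
  consists of the multiples by \<open>p\<close> of the divisors of \<open>n/p\<close>.\<close>

lemma sum_chi3_recursion:
  assumes p: "prime p" and n: "n > 0"
  shows "(\<Sum>d | d dvd p * n. chi3 d) = (1 + chi3 p) * (\<Sum>d | d dvd n. chi3 d)
      - (if p dvd n then chi3 p * (\<Sum>d | d dvd n div p. chi3 d) else 0)"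
proof -
  define D where "D m = {d. d dvd m}" for m :: nat
  have p0: "p > 0" using p prime_gt_0_nat by simp
  have fin: "finite (D m)" if "m > 0" for m using that by (simp add: D_def)
  have inj: "inj_on ((*) p) A" for A using p0 by (auto simp: inj_on_def)
  have shift: "sum chi3 ((*) p ` D m) = chi3 p * sum chi3 (D m)" for m
    by (simp add: sum.reindex[OF inj] chi3_mult sum_distrib_left)
  have un: "D (p * n) = D n \<union> (*) p ` D n"
  proof (intro equalityI subsetI)
    fix d assume d: "d \<in> D (p * n)"
    show "d \<in> D n \<union> (*) p ` D n"
    proof (cases "p dvd d")
      case True
      then obtain e where "d = p * e" by (elim dvdE)
      with d p0 show ?thesis by (auto simp: D_def)
    next
      case False
      then have "coprime d p" using p by (metis coprime_commute prime_imp_coprime)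
      with d show ?thesis by (simp add: D_def coprime_dvd_mult_right_iff)
    qed
  qed (auto simp: D_def)
  have int: "D n \<inter> (*) p ` D n = (if p dvd n then (*) p ` D (n div p) else {})"
  proof (cases "p dvd n")
    case True
    then obtain m where "n = p * m" by (elim dvdE)
    with p0 show ?thesis by (auto simp: D_def intro: dvd_mult)
  next
    case False
    then show ?thesis by (auto simp: D_def dest: dvd_mult_left)
  qed
  have "sum chi3 (D n \<union> (*) p ` D n) + sum chi3 (D n \<inter> (*) p ` D n) = sum chi3 (D n) + sum chi3 ((*) p ` D n)"
    using fin[OF n] by (intro sum.union_inter) auto
  moreover have "sum chi3 (D n \<inter> (*) p ` D n) = (if p dvd n then chi3 p * sum chi3 (D (n div p)) else 0)"
    using shift[of "n div p"] by (simp only: int split: if_split) simp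
  moreover have "(1 + chi3 p) * sum chi3 (D n) = sum chi3 (D n) + sum chi3 ((*) p ` D n)"
    by (simp only: shift distrib_right mult_1)
  ultimately show ?thesis
    unfolding D_def[symmetric] un by linarith
qed

lemma card_eis_points_1: "card (eis_points 1) = 6"
proof -
  have "eis_points 1 = {(1, 0), (- 1, 0), (0, 1), (0, - 1), (1, - 1), (- 1, 1)}"
  proof (intro equalityI subsetI)
    fix z assume "z \<in> eis_points 1"
    then obtain x y where z: "z = (x, y)" "eis_norm x y = 1" by (auto simp: eis_points_def)
    then have "x^2 \<le> 1" "y^2 \<le> 1" using square_le_eis_norm[where x = x and y = y] by linarith+
    then have "\<bar>x\<bar> \<le> 1" "\<bar>y\<bar> \<le> 1" by (simp_all add: abs_square_le_1)
    then have "x \<in> {-1, 0, 1}" "y \<in> {-1, 0, 1}" by auto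
    with z show "z \<in> {(1, 0), (- 1, 0), (0, 1), (0, - 1), (1, - 1), (- 1, 1)}"
      by (auto simp: eis_norm_def)
  qed (auto simp: eis_points_def eis_norm_def)
  then show ?thesis by simp
qed

theorem card_eis_points:
  "n > 0 \<Longrightarrow> int (card (eis_points n)) = 6 * (\<Sum>d | d dvd n. chi3 d)"
proof (induction n rule: less_induct)
  case (less n)
  show ?case
  proof (cases "n = 1")
    case True
    then show ?thesis using card_eis_points_1 by (simp add: chi3_def)
  next
    case False
    then obtain p where p: "prime p" "p dvd n" using prime_factor_nat by blast
    then obtain m where m: "n = p * m" by (elim dvdE)
    have "p > 1" using p prime_gt_1_nat by blast
    with m less.prems have "m > 0" "m < n" by auto
    have "int (card (eis_points (m div p))) = 6 * (\<Sum>d | d dvd m div p. chi3 d)" if "p dvd m"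
    proof -
      from that \<open>m > 0\<close> \<open>p > 1\<close> have "m div p > 0" "m div p < n"
        using \<open>m < n\<close> by (auto simp: dvd_imp_le div_greater_zero_iff intro: le_less_trans[OF div_le_dividend])
      then show ?thesis by (intro less.IH) auto
    qed
    moreover have "int (card (eis_points m)) = 6 * (\<Sum>d | d dvd m. chi3 d)"
      using \<open>m > 0\<close> \<open>m < n\<close> by (intro less.IH)
    ultimately show ?thesis
      unfolding m card_eis_points_recursion[OF p(1)] sum_chi3_recursion[OF p(1) \<open>m > 0\<close>]
      by (auto simp: algebra_simps)
  qed
qed

section \<open>Liouville's convolution identity\<close>

definition quadruples :: "nat \<Rightarrow> (nat \<times> nat \<times> nat \<times> nat) set" where
  "quadruples n = {(a, b, x, y). 0 < a \<and> 0 < b \<and> 0 < x \<and> 0 < y \<and> a * x + b * y = n}"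

lemma finite_quadruples [simp]: "finite (quadruples n)"
proof (rule finite_subset)
  show "quadruples n \<subseteq> {..n} \<times> {..n} \<times> {..n} \<times> {..n}"
  proof (clarsimp simp: quadruples_def)
    fix a b x y :: nat
    assume "0 < a" "0 < b" "0 < x" "0 < y"
    then have "a \<le> a * x" "x \<le> a * x" "b \<le> b * y" "y \<le> b * y" by auto
    then show "a \<le> a * x + b * y \<and> b \<le> a * x + b * y \<and> x \<le> a * x + b * y \<and> y \<le> a * x + b * y"
      by linarith
  qed
qed simp

lemma sum_trichotomy:
  fixes h :: "'a \<Rightarrow> 'b::comm_monoid_add" and u v :: "'a \<Rightarrow> nat"
  assumes "finite A"
  shows "sum h A = sum h {q \<in> A. u q = v q} + sum h {q \<in> A. u q > v q} + sum h {q \<in> A. u q < v q}"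
proof -
  have "A = ({q \<in> A. u q = v q} \<union> {q \<in> A. u q > v q}) \<union> {q \<in> A. u q < v q}" by auto
  then have "sum h A = sum h (({q \<in> A. u q = v q} \<union> {q \<in> A. u q > v q}) \<union> {q \<in> A. u q < v q})" by simp
  also have "\<dots> = sum h ({q \<in> A. u q = v q} \<union> {q \<in> A. u q > v q}) + sum h {q \<in> A. u q < v q}"
    using assms by (intro sum.union_disjoint) auto
  also have "sum h ({q \<in> A. u q = v q} \<union> {q \<in> A. u q > v q})
      = sum h {q \<in> A. u q = v q} + sum h {q \<in> A. u q > v q}"
    using assms by (intro sum.union_disjoint) auto
  finally show ?thesis .
qed

abbreviation (input) "qa \<equiv> (fst :: nat \<times> nat \<times> nat \<times> nat \<Rightarrow> nat)"
abbreviation (input) "qb \<equiv> (\<lambda>q :: nat \<times> nat \<times> nat \<times> nat. fst (snd q))"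
abbreviation (input) "qx \<equiv> (\<lambda>q :: nat \<times> nat \<times> nat \<times> nat. fst (snd (snd q)))"
abbreviation (input) "qy \<equiv> (\<lambda>q :: nat \<times> nat \<times> nat \<times> nat. snd (snd (snd q)))"

text \<open>The substitution \<open>a x + b y = a (x - y) + (a + b) y\<close> is a bijection from the quadruples with
  \<open>y < x\<close> to those with \<open>a < b\<close>. It is the source of every cancellation in Liouville's identity.\<close>

lemma sum_shear_quadruples:
  "(\<Sum>q \<in> {q \<in> quadruples n. qy q < qx q}. h (qa q) (qb q) (qx q) (qy q)) =
   (\<Sum>q \<in> {q \<in> quadruples n. qa q < qb q}. h (qa q) (qb q - qa q) (qx q + qy q) (qy q))"
  by (rule sum.reindex_bij_witness
       [where i = "\<lambda>(a, b, x, y). (a, b - a, x + y, y)" and j = "\<lambda>(a, b, x, y). (a, a + b, x - y, y)"])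
     (auto simp: quadruples_def algebra_simps diff_mult_distrib trans_le_add1)

lemma sum_swap_quadruples:
  assumes "\<And>a b x y. P a b x y \<longleftrightarrow> P' b a y x"
  shows "(\<Sum>q \<in> {q \<in> quadruples n. P (qa q) (qb q) (qx q) (qy q)}. h (qa q) (qb q) (qx q) (qy q)) =
   (\<Sum>q \<in> {q \<in> quadruples n. P' (qa q) (qb q) (qx q) (qy q)}. h (qb q) (qa q) (qy q) (qx q))"
  by (rule sum.reindex_bij_witness
       [where i = "\<lambda>(a, b, x, y). (b, a, y, x)" and j = "\<lambda>(a, b, x, y). (b, a, y, x)"])
     (auto simp: quadruples_def assms algebra_simps)

lemma sum_quadruples_diag_ab:
  assumes "n > 0"
  shows "(\<Sum>q \<in> {q \<in> quadruples n. qa q = qb q}. h (qa q)) =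
    (\<Sum>d | d dvd n. of_nat (n div d - 1) * (h d :: int))"
proof -
  have "(\<Sum>d | d dvd n. of_nat (n div d - 1) * h d) = (\<Sum>d | d dvd n. \<Sum>x \<in> {1..<n div d}. h d)"
    by simp
  also have "\<dots> = (\<Sum>(d, x) \<in> (SIGMA d : {d. d dvd n}. {1..<n div d}). h d)"
    using assms by (subst sum.Sigma) auto
  also have "\<dots> = (\<Sum>q \<in> {q \<in> quadruples n. qa q = qb q}. h (qa q))"
  proof (rule sum.reindex_bij_witness
     [where i = "\<lambda>(a, b, x, y). (a, x)" and j = "\<lambda>(d, x). (d, d, x, n div d - x)"], goal_cases)
    case (2 p)
    then obtain d x where "p = (d, x)" "d dvd n" "1 \<le> x" "x < n div d" by auto
    moreover from this obtain k where "n = d * k" by (elim dvdE)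
    ultimately show ?case using assms by (auto simp: quadruples_def simp flip: distrib_left)
  next
    case (4 q)
    then obtain a x y where "q = (a, a, x, y)" "0 < a" "0 < x" "0 < y" "n = a * (x + y)"
      by (auto simp: quadruples_def distrib_left)
    then show ?case by auto
  next
    case (3 q)
    then obtain a x y where "q = (a, a, x, y)" "0 < a" "0 < x" "0 < y" "n = a * (x + y)"
      by (auto simp: quadruples_def distrib_left)
    then show ?case by auto
  qed auto
  finally show ?thesis by simp
qed

lemma sum_quadruples_diag_xy:
  assumes "n > 0"
  shows "(\<Sum>q \<in> {q \<in> quadruples n. qx q = qy q}. h (qa q) (qa q + qb q)) =
    (\<Sum>d | d dvd n. \<Sum>a \<in> {1..<d}. (h a d :: int))"
proof -
  have "(\<Sum>d | d dvd n. \<Sum>a \<in> {1..<d}. h a d) = (\<Sum>(d, a) \<in> (SIGMA d : {d. d dvd n}. {1..<d}). h a d)"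
    using assms by (subst sum.Sigma) auto
  also have "\<dots> = (\<Sum>q \<in> {q \<in> quadruples n. qx q = qy q}. h (qa q) (qa q + qb q))"
  proof (rule sum.reindex_bij_witness
     [where i = "\<lambda>(a, b, x, y). (a + b, a)" and j = "\<lambda>(d, a). (a, d - a, n div d, n div d)"], goal_cases)
    case (2 p)
    then obtain d a where "p = (d, a)" "d dvd n" "1 \<le> a" "a < d" by auto
    moreover from this obtain k where "n = d * k" by (elim dvdE)
    ultimately show ?case using assms by (auto simp: quadruples_def simp flip: distrib_right)
  next
    case (4 q)
    then obtain a x b where "q = (a, b, x, x)" "0 < a" "0 < x" "0 < b" "n = (a + b) * x"
      by (auto simp: quadruples_def distrib_right)
    then show ?case by auto
  next
    case (3 q)
    then obtain a x b where "q = (a, b, x, x)" "0 < a" "0 < x" "0 < b" "n = (a + b) * x"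
      by (auto simp: quadruples_def distrib_right)
    then show ?case by auto
  qed auto
  finally show ?thesis by simp
qed

text \<open>Denote by \<open>S P\<close> the sum of \<open>F a\<close> over the quadruples with property \<open>P\<close>. Off the diagonals
  \<open>a = b\<close> and \<open>x = y\<close> the shear turns \<open>F(a - b)\<close> into \<open>2 S (x < y)\<close> and \<open>F(a + b)\<close> into
  \<open>2 S (b < a)\<close>. The shear also gives \<open>S (y < x) = S (a < b)\<close>, and splitting the full sum along
  either diagonal then yields \<open>S (x < y) - S (b < a) = S (a = b) - S (x = y)\<close>. Only diagonal sums
  remain, and these run over the divisors of \<open>n\<close>.\<close>

theorem liouville_identity:
  fixes F :: "int \<Rightarrow> int"
  assumes "n > 0" and even: "\<And>k. F (- k) = F k"
  shows "(\<Sum>q \<in> quadruples n. F (int (qa q) - int (qb q)) - F (int (qa q) + int (qb q))) =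
    (\<Sum>d | d dvd n. int (n div d - 1) * F 0 - int (d - 1) * F (int d)
        + 2 * (int (n div d - 1) * F (int d)) - 2 * (\<Sum>a \<in> {1..<d}. F (int a)))"
proof -
  let ?Q = "quadruples n"
  define S where "S P = (\<Sum>q \<in> {q \<in> ?Q. P q}. F (int (qa q)))" for P
  have total1: "sum (\<lambda>q. F (int (qa q))) ?Q = S (\<lambda>q. qa q = qb q) + S (\<lambda>q. qa q > qb q) + S (\<lambda>q. qa q < qb q)"
    unfolding S_def by (rule sum_trichotomy) simp
  have total2: "sum (\<lambda>q. F (int (qa q))) ?Q = S (\<lambda>q. qx q = qy q) + S (\<lambda>q. qx q > qy q) + S (\<lambda>q. qx q < qy q)"
    unfolding S_def by (rule sum_trichotomy) simp
  have shear: "S (\<lambda>q. qx q > qy q) = S (\<lambda>q. qa q < qb q)"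
    unfolding S_def by (rule sum_shear_quadruples)
  have gap: "S (\<lambda>q. qx q < qy q) - S (\<lambda>q. qa q > qb q) = S (\<lambda>q. qa q = qb q) - S (\<lambda>q. qx q = qy q)"
    using total1 total2 shear by linarith

  have minus_swap: "(\<Sum>q \<in> {q \<in> ?Q. qa q > qb q}. F (int (qa q) - int (qb q))) =
        (\<Sum>q \<in> {q \<in> ?Q. qa q < qb q}. F (int (qa q) - int (qb q)))"
  proof -
    have "F (int b - int a) = F (int a - int b)" for a b
      using even[of "int a - int b"] by simp
    then show ?thesis
      by (subst sum_swap_quadruples[where P' = "\<lambda>a b x y. a < b"]) auto
  qed
  have minus: "(\<Sum>q \<in> {q \<in> ?Q. qa q < qb q}. F (int (qa q) - int (qb q))) = S (\<lambda>q. qx q < qy q)"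
  proof -
    have "(\<Sum>q \<in> {q \<in> ?Q. qa q < qb q}. F (int (qa q) - int (qb q))) =
      (\<Sum>q \<in> {q \<in> ?Q. qa q < qb q}. F (int (qb q - qa q)))"
    proof (rule sum.cong)
      fix q assume "q \<in> {q \<in> ?Q. qa q < qb q}"
      then show "F (int (qa q) - int (qb q)) = F (int (qb q - qa q))"
        using even[of "int (qb q - qa q)"] by (simp add: of_nat_diff)
    qed simp
    also have "\<dots> = (\<Sum>q \<in> {q \<in> ?Q. qx q > qy q}. F (int (qb q)))"
      by (rule sum_shear_quadruples[symmetric])
    also have "\<dots> = S (\<lambda>q. qx q < qy q)"
      unfolding S_def by (rule sum_swap_quadruples) simp
    finally show ?thesis .
  qed
  have "sum (\<lambda>q. F (int (qa q) - int (qb q))) ?Q =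
     (\<Sum>q \<in> {q \<in> ?Q. qa q = qb q}. F (int (qa q) - int (qb q))) + 2 * S (\<lambda>q. qx q < qy q)"
    by (subst sum_trichotomy[where u = qa and v = qb]) (simp_all add: minus minus_swap)
  also have "(\<Sum>q \<in> {q \<in> ?Q. qa q = qb q}. F (int (qa q) - int (qb q))) = (\<Sum>q \<in> {q \<in> ?Q. qa q = qb q}. F 0)"
    by (rule sum.cong) auto
  finally have A: "sum (\<lambda>q. F (int (qa q) - int (qb q))) ?Q =
     (\<Sum>d | d dvd n. int (n div d - 1) * F 0) + 2 * S (\<lambda>q. qx q < qy q)"
    using sum_quadruples_diag_ab[OF assms(1), of "\<lambda>_. F 0"] by simp

  have plus_swap: "(\<Sum>q \<in> {q \<in> ?Q. qx q < qy q}. F (int (qa q) + int (qb q))) =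
        (\<Sum>q \<in> {q \<in> ?Q. qx q > qy q}. F (int (qa q) + int (qb q)))"
    by (subst sum_swap_quadruples[where P' = "\<lambda>a b x y. x > y"]) (auto simp: add.commute)
  have plus: "(\<Sum>q \<in> {q \<in> ?Q. qx q > qy q}. F (int (qa q) + int (qb q))) = S (\<lambda>q. qa q > qb q)"
  proof -
    have "(\<Sum>q \<in> {q \<in> ?Q. qx q > qy q}. F (int (qa q) + int (qb q))) =
       (\<Sum>q \<in> {q \<in> ?Q. qa q < qb q}. F (int (qa q) + int (qb q - qa q)))"
      by (rule sum_shear_quadruples)
    also have "\<dots> = (\<Sum>q \<in> {q \<in> ?Q. qa q < qb q}. F (int (qb q)))"
      by (rule sum.cong) (auto simp: of_nat_diff)
    also have "\<dots> = S (\<lambda>q. qa q > qb q)"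
      unfolding S_def by (rule sum_swap_quadruples) simp
    finally show ?thesis .
  qed
  have "sum (\<lambda>q. F (int (qa q) + int (qb q))) ?Q =
     (\<Sum>q \<in> {q \<in> ?Q. qx q = qy q}. F (int (qa q) + int (qb q))) + 2 * S (\<lambda>q. qa q > qb q)"
    by (subst sum_trichotomy[where u = qx and v = qy]) (simp_all add: plus plus_swap)
  also have "(\<Sum>q \<in> {q \<in> ?Q. qx q = qy q}. F (int (qa q) + int (qb q))) =
      (\<Sum>d | d dvd n. int (d - 1) * F (int d))"
    using sum_quadruples_diag_xy[OF assms(1), of "\<lambda>a d. F (int d)"] by simp
  finally have B: "sum (\<lambda>q. F (int (qa q) + int (qb q))) ?Q =
      (\<Sum>d | d dvd n. int (d - 1) * F (int d)) + 2 * S (\<lambda>q. qa q > qb q)" .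

  have C: "S (\<lambda>q. qa q = qb q) = (\<Sum>d | d dvd n. int (n div d - 1) * F (int d))"
    unfolding S_def by (rule sum_quadruples_diag_ab[OF assms(1)])
  have D: "S (\<lambda>q. qx q = qy q) = (\<Sum>d | d dvd n. \<Sum>a \<in> {1..<d}. F (int a))"
    unfolding S_def by (rule sum_quadruples_diag_xy[OF assms(1), of "\<lambda>a _. F (int a)"])
  show ?thesis
    using A B C D gap
    by (simp add: sum_subtractf sum.distrib sum_distrib_left[symmetric] del: of_nat_diff)
qed

text \<open>The value \<open>2 cos (2 \<pi> k / 3)\<close>.\<close>

definition trace3 :: "int \<Rightarrow> int" where
  "trace3 k = (if 3 dvd k then 2 else - 1)"

text \<open>The product formula \<open>2 sin \<alpha> sin \<beta> = cos (\<alpha> - \<beta>) - cos (\<alpha> + \<beta>)\<close>, as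
  \<open>chi3 k = (2 / sqrt 3) sin (2 \<pi> k / 3)\<close>.\<close>

lemma chi3_mult_chi3:
  "3 * (chi3 a * chi3 b) = trace3 (int a - int b) - trace3 (int a + int b)"
proof -
  have "a mod 3 = 0 \<or> a mod 3 = 1 \<or> a mod 3 = 2" "b mod 3 = 0 \<or> b mod 3 = 1 \<or> b mod 3 = 2" by auto
  moreover have "3 dvd int a - int b \<longleftrightarrow> a mod 3 = b mod 3" by presburger
  moreover have "3 dvd int a + int b \<longleftrightarrow> (a mod 3 + b mod 3) mod 3 = 0" by presburger
  ultimately show ?thesis by (elim disjE) (simp_all add: chi3_def trace3_def)
qed

lemma sum_trace3: "d > 0 \<Longrightarrow> (\<Sum>a \<in> {1..<d}. trace3 (int a)) = (if d mod 3 = 0 then - 2 else if d mod 3 = 1 then 0 else - 1)"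
proof (induction d rule: nat_induct_non_zero)
  case (Suc d)
  have "3 dvd int d \<longleftrightarrow> d mod 3 = 0" by presburger
  then show ?case using Suc by (auto simp: trace3_def mod_Suc)
qed simp

text \<open>In Liouville's identity for \<open>trace3\<close> the summand at a divisor \<open>d\<close> is \<open>d - chi3 d\<close>, with a correction
  \<open>6 n/d - 3 d\<close> when 3 divides \<open>d\<close>. The corrections add up to \<open>6 \<sigma>(n/3) - 9 \<sigma>(n/3)\<close>.\<close>

theorem convolution_chi3:
  assumes "n > 0"
  shows "3 * (\<Sum>q \<in> quadruples n. chi3 (qa q) * chi3 (qb q)) =
     int (\<Sum>d | d dvd n. d) - 3 * int (sigma (of_nat n / 3)) - (\<Sum>d | d dvd n. chi3 d)"
proof -
  define D where "D = {d. d dvd n}"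
  have fin: "finite D" using assms by (simp add: D_def)
  have "3 * (\<Sum>q \<in> quadruples n. chi3 (qa q) * chi3 (qb q)) =
     (\<Sum>q \<in> quadruples n. trace3 (int (qa q) - int (qb q)) - trace3 (int (qa q) + int (qb q)))"
    by (simp add: sum_distrib_left chi3_mult_chi3)
  also have "\<dots> = (\<Sum>d \<in> D. int (n div d - 1) * trace3 0 - int (d - 1) * trace3 (int d)
        + 2 * (int (n div d - 1) * trace3 (int d)) - 2 * (\<Sum>a \<in> {1..<d}. trace3 (int a)))"
    unfolding D_def by (rule liouville_identity[OF assms]) (simp add: trace3_def)
  also have "\<dots> = (\<Sum>d \<in> D. int d - chi3 d + (if 3 dvd d then 6 * int (n div d) - 3 * int d else 0))"
  proof (rule sum.cong)
    fix d assume "d \<in> D"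
    then have "d > 0" "n div d > 0" using assms by (auto simp: D_def dvd_div_eq_0_iff intro: Nat.gr0I)
    moreover have "3 dvd int d \<longleftrightarrow> d mod 3 = 0" "3 dvd d \<longleftrightarrow> d mod 3 = 0" by presburger+
    moreover have "d mod 3 = 0 \<or> d mod 3 = 1 \<or> d mod 3 = 2" by auto
    ultimately show "int (n div d - 1) * trace3 0 - int (d - 1) * trace3 (int d)
        + 2 * (int (n div d - 1) * trace3 (int d)) - 2 * (\<Sum>a \<in> {1..<d}. trace3 (int a)) =
        int d - chi3 d + (if 3 dvd d then 6 * int (n div d) - 3 * int d else 0)"
      unfolding sum_trace3[OF \<open>d > 0\<close>]
      by (elim disjE) (simp_all add: trace3_def chi3_def int_ops(6) algebra_simps)
  qed simp
  also have "\<dots> = int (\<Sum>d \<in> D. d) - (\<Sum>d \<in> D. chi3 d) +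
      (\<Sum>d \<in> D. if 3 dvd d then 6 * int (n div d) - 3 * int d else 0)"
    by (simp add: sum.distrib sum_subtractf)
  also have "(\<Sum>d \<in> D. if 3 dvd d then 6 * int (n div d) - 3 * int d else 0) =
       (\<Sum>d \<in> {d \<in> D. 3 dvd d}. 6 * int (n div d) - 3 * int d)"
    using fin by (rule sum.inter_filter[symmetric])
  also have "\<dots> = - 3 * int (sigma (of_nat n / 3))"
  proof (cases "3 dvd n")
    case True
    then obtain m where m: "n = 3 * m" by auto
    with assms have "m > 0" by simp
    have s: "sigma (of_nat n / 3) = (\<Sum>d | d dvd m. d)"
      using \<open>m > 0\<close> by (simp add: sigma_def m)
    have flip: "(\<Sum>d | d dvd m. m div d) = (\<Sum>d | d dvd m. d)"
      by (rule sum.reindex_bij_witness[where i = "\<lambda>d. m div d" and j = "\<lambda>d. m div d"])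
         (use \<open>m > 0\<close> in auto)
    have "(\<Sum>d \<in> {d \<in> D. 3 dvd d}. 6 * int (n div d) - 3 * int d) =
        (\<Sum>d | d dvd m. 6 * int (m div d) - 9 * int d)"
      by (rule sum.reindex_bij_witness[where i = "\<lambda>d. 3 * d" and j = "\<lambda>d. d div 3"])
         (auto simp: D_def m)
    also have "\<dots> = 6 * int (\<Sum>d | d dvd m. m div d) - 9 * int (\<Sum>d | d dvd m. d)"
      by (simp add: sum_subtractf sum_distrib_left)
    finally show ?thesis unfolding flip s by simp
  next
    case False
    then have "sigma (of_nat n / 3) = 0" using sigma_divide[of 3 n] by simp
    moreover have "{d \<in> D. 3 dvd d} = {}" using False by (auto simp: D_def intro: dvd_trans)
    ultimately show ?thesis by (simp del: Collect_empty_eq)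
  qed
  finally show ?thesis by (simp add: D_def)
qed

section \<open>Representations by a sum of two forms\<close>

definition reps :: "('a \<Rightarrow> int) \<Rightarrow> nat \<Rightarrow> 'a set" where
  "reps q n = {z. q z = int n}"

definition splittings :: "nat \<Rightarrow> nat \<Rightarrow> nat \<Rightarrow> (nat \<times> nat) set" where
  "splittings c d n = {(l, m). c * l + d * m = n}"

lemma finite_splittings:
  assumes "c > 0" "d > 0"
  shows "finite (splittings c d n)"
proof (rule finite_subset)
  show "splittings c d n \<subseteq> {..n} \<times> {..n}"
  proof (clarsimp simp: splittings_def)
    fix l m :: nat
    have "l \<le> c * l" "m \<le> d * m" using assms by auto
    then show "l \<le> c * l + d * m \<and> m \<le> c * l + d * m" by linarith
  qed
qed simp

lemma
  fixes q :: "'a \<Rightarrow> int"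
  assumes nonneg: "\<And>z. q z \<ge> 0" and fin: "\<And>k. finite (reps q k)" and cd: "c > 0" "d > 0"
  shows card_reps_sum: "card {(z, w). int n = int c * q z + int d * q w} =
      (\<Sum>(l, m) \<in> splittings c d n. card (reps q l) * card (reps q m))"
    and finite_reps_sum: "finite {(z, w). int n = int c * q z + int d * q w}"
proof -
  have eq: "{(z, w). int n = int c * q z + int d * q w} =
      (\<Union>p \<in> splittings c d n. reps q (fst p) \<times> reps q (snd p))"
  proof (intro equalityI subsetI)
    fix p assume "p \<in> {(z, w). int n = int c * q z + int d * q w}"
    then obtain z w where p: "p = (z, w)" "int n = int c * q z + int d * q w" by auto
    have "q z = int (nat (q z))" "q w = int (nat (q w))" using nonneg by simp_all
    moreover from this have "int n = int (c * nat (q z) + d * nat (q w))" using p by simp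
    then have "(nat (q z), nat (q w)) \<in> splittings c d n"
      unfolding splittings_def of_nat_eq_iff by simp
    ultimately show "p \<in> (\<Union>p \<in> splittings c d n. reps q (fst p) \<times> reps q (snd p))"
      unfolding p by (intro UN_I[where a = "(nat (q z), nat (q w))"]) (simp_all add: reps_def)
  qed (auto simp: reps_def splittings_def)
  show "finite {(z, w). int n = int c * q z + int d * q w}"
    unfolding eq using finite_splittings[OF cd] fin by auto
  have "card (\<Union>p \<in> splittings c d n. reps q (fst p) \<times> reps q (snd p)) =
     (\<Sum>p \<in> splittings c d n. card (reps q (fst p) \<times> reps q (snd p)))"
    using finite_splittings[OF cd] fin by (intro card_UN_disjoint) (auto simp: reps_def)
  then show "card {(z, w). int n = int c * q z + int d * q w} =
      (\<Sum>(l, m) \<in> splittings c d n. card (reps q l) * card (reps q m))"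
    unfolding eq by (simp add: card_cartesian_product case_prod_unfold)
qed

lemma sum_splittings_swap:
  "(\<Sum>(l, m) \<in> splittings c d n. h l m) = (\<Sum>(l, m) \<in> splittings d c n. h m l)"
  by (rule sum.reindex_bij_witness[where i = prod.swap and j = prod.swap])
     (auto simp: splittings_def)

lemma sum_splittings_boundary:
  assumes "c > 0" "d > 0"
  shows "(\<Sum>(l, m) \<in> splittings c d n. if l = 0 then h m else 0) =
    (if d dvd n then h (n div d) else (0 :: int))"
proof -
  have "(\<Sum>(l, m) \<in> splittings c d n. if l = 0 then h m else 0) =
     (\<Sum>p \<in> splittings c d n. if fst p = 0 then h (snd p) else 0)"
    by (simp add: case_prod_unfold)
  also have "\<dots> = (\<Sum>p \<in> {p \<in> splittings c d n. fst p = 0}. h (snd p))"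
    using finite_splittings[OF assms] by (rule sum.inter_filter[symmetric])
  also have "{p \<in> splittings c d n. fst p = 0} = (if d dvd n then {(0, n div d)} else {})"
    using assms by (auto simp: splittings_def intro!: Nat.gr0I)
  finally show ?thesis by simp
qed

text \<open>Here \<open>f\<close> is a sequence of representation numbers and \<open>h\<close> the arithmetic formula for them, which
  gives 0 instead of 1 at 0. As \<open>n\<close> is positive, \<open>l\<close> and \<open>m\<close> are never both 0.\<close>

lemma sum_splittings_expand:
  fixes f h :: "nat \<Rightarrow> int"
  assumes cd: "c > 0" "d > 0" and "n > 0"
    and f: "f 0 = 1" "h 0 = 0" "\<And>k. k > 0 \<Longrightarrow> f k = h k"
  shows "(\<Sum>(l, m) \<in> splittings c d n. f l * f m) =
     (if c dvd n then h (n div c) else 0) + (if d dvd n then h (n div d) else 0)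
     + (\<Sum>(l, m) \<in> splittings c d n. h l * h m)"
proof -
  have "(\<Sum>(l, m) \<in> splittings c d n. f l * f m) =
     (\<Sum>(l, m) \<in> splittings c d n. (if m = 0 then h l else 0) + (if l = 0 then h m else 0) + h l * h m)"
  proof (rule sum.cong)
    fix p assume "p \<in> splittings c d n"
    then obtain l m where p: "p = (l, m)" "l > 0 \<or> m > 0"
      using \<open>n > 0\<close> by (cases p) (auto simp: splittings_def)
    then show "(case p of (l, m) \<Rightarrow> f l * f m) = (case p of (l, m) \<Rightarrow>
        (if m = 0 then h l else 0) + (if l = 0 then h m else 0) + h l * h m)"
      using f by auto
  qed simp
  also have "\<dots> = (\<Sum>(l, m) \<in> splittings c d n. if m = 0 then h l else 0)
      + (\<Sum>(l, m) \<in> splittings c d n. if l = 0 then h m else 0)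
      + (\<Sum>(l, m) \<in> splittings c d n. h l * h m)"
    by (simp add: case_prod_unfold sum.distrib)
  also have "(\<Sum>(l, m) \<in> splittings c d n. if m = 0 then h l else 0) =
      (\<Sum>(l, m) \<in> splittings d c n. if l = 0 then h m else 0)"
    by (rule sum_splittings_swap)
  finally show ?thesis using cd by (simp add: sum_splittings_boundary)
qed

section \<open>The quaternary form\<close>

text \<open>Writing \<open>l = a x\<close> and \<open>m = b y\<close> turns a splitting with a divisor of each part into a
  quadruple.\<close>

lemma sum_splittings_divisors:
  fixes g :: "nat \<Rightarrow> int"
  shows "(\<Sum>(l, m) \<in> splittings 1 1 n.
        (if l = 0 then 0 else \<Sum>a | a dvd l. g a) * (if m = 0 then 0 else \<Sum>b | b dvd m. g b)) =
     (\<Sum>q \<in> quadruples n. g (qa q) * g (qb q))"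
proof -
  define P where "P = {p \<in> splittings 1 1 n. 0 < fst p \<and> 0 < snd p}"
  define D where "D p = {a. a dvd fst p} \<times> {b. b dvd snd p}" for p :: "nat \<times> nat"
  have fin: "finite (splittings 1 1 n)" by (rule finite_splittings) auto
  have "(\<Sum>(l, m) \<in> splittings 1 1 n.
        (if l = 0 then 0 else \<Sum>a | a dvd l. g a) * (if m = 0 then 0 else \<Sum>b | b dvd m. g b)) =
     (\<Sum>p \<in> P. (\<Sum>a | a dvd fst p. g a) * (\<Sum>b | b dvd snd p. g b))"
    by (rule sum.mono_neutral_cong_right) (use fin in \<open>auto simp: P_def split: if_splits\<close>)
  also have "\<dots> = (\<Sum>p \<in> P. \<Sum>(a, b) \<in> D p. g a * g b)"
    by (simp add: D_def sum_product sum.cartesian_product)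
  also have "\<dots> = (\<Sum>(p, a, b) \<in> Sigma P D. g a * g b)"
    using fin by (subst sum.Sigma) (auto simp: P_def D_def)
  also have "\<dots> = (\<Sum>q \<in> quadruples n. g (qa q) * g (qb q))"
    by (rule sum.reindex_bij_witness
        [where i = "\<lambda>(a, b, x, y). ((a * x, b * y), a, b)" and j = "\<lambda>((l, m), a, b). (a, b, l div a, m div b)"])
       (auto simp: P_def D_def quadruples_def splittings_def elim!: dvdE)
  finally show ?thesis .
qed

definition binary_form :: "int \<times> int \<Rightarrow> int" where
  "binary_form = (\<lambda>(x, y). eis_norm x y)"

definition quaternary_form :: "(int \<times> int) \<times> (int \<times> int) \<Rightarrow> int" where
  "quaternary_form = (\<lambda>(z, w). binary_form z + binary_form w)"

lemma binary_form_nonneg: "binary_form z \<ge> 0"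
  by (cases z) (simp add: binary_form_def eis_norm_nonneg)

lemma quaternary_form_nonneg: "quaternary_form z \<ge> 0"
  by (cases z) (simp add: quaternary_form_def binary_form_nonneg)

lemma reps_binary_form: "reps binary_form n = eis_points n"
  by (auto simp: reps_def binary_form_def eis_points_def)

lemma reps_quaternary_form:
  "reps quaternary_form n = {(z, w). int n = int 1 * binary_form z + int 1 * binary_form w}"
  by (auto simp: reps_def quaternary_form_def)

lemma finite_reps_quaternary_form: "finite (reps quaternary_form n)"
  unfolding reps_quaternary_form
  by (rule finite_reps_sum) (simp_all add: binary_form_nonneg reps_binary_form)

lemma card_eis_points_0: "card (eis_points 0) = 1"
proof -
  have "eis_points 0 = {(0, 0)}" by (auto simp: eis_points_def eis_norm_eq_0_iff)
  then show ?thesis by simp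
qed

lemma card_reps_quaternary_form_0: "card (reps quaternary_form 0) = 1"
proof -
  have "splittings 1 1 0 = {(0, 0)}" by (auto simp: splittings_def)
  then show ?thesis
    unfolding reps_quaternary_form
    by (subst card_reps_sum)
       (simp_all add: binary_form_nonneg reps_binary_form card_eis_points_0[simplified])
qed

text \<open>The boundary terms contribute \<open>12 g(n)\<close> for the divisor sum \<open>g\<close> of \<open>chi3\<close>, and the rest is 36 times
  the convolution of \<open>g\<close> with itself, whose own term \<open>- g(n)/3\<close> cancels the boundary terms.\<close>

theorem card_reps_quaternary_form:
  assumes "n > 0"
  shows "int (card (reps quaternary_form n)) =
    12 * int (sigma (of_nat n)) - 36 * int (sigma (of_nat n / 3))"
proof -
  define g where "g k = (if k = 0 then 0 else \<Sum>d | d dvd k. chi3 d)" for k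
  have "card (reps quaternary_form n) =
      (\<Sum>(l, m) \<in> splittings 1 1 n. card (eis_points l) * card (eis_points m))"
    unfolding reps_quaternary_form
    by (subst card_reps_sum) (simp_all add: binary_form_nonneg reps_binary_form)
  then have "int (card (reps quaternary_form n)) =
      (\<Sum>(l, m) \<in> splittings 1 1 n. int (card (eis_points l)) * int (card (eis_points m)))"
    by (simp add: case_prod_unfold)
  also have "\<dots> = 6 * g n + 6 * g n + (\<Sum>(l, m) \<in> splittings 1 1 n. 6 * g l * (6 * g m))"
    using assms
    by (subst sum_splittings_expand[where h = "\<lambda>k. 6 * g k"])
       (simp_all add: card_eis_points_0 card_eis_points g_def)
  also have "(\<Sum>(l, m) \<in> splittings 1 1 n. 6 * g l * (6 * g m)) =
      36 * (\<Sum>(l, m) \<in> splittings 1 1 n. g l * g m)"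
    by (simp add: sum_distrib_left case_prod_unfold)
  also have "(\<Sum>(l, m) \<in> splittings 1 1 n. g l * g m) = (\<Sum>q \<in> quadruples n. chi3 (qa q) * chi3 (qb q))"
    unfolding g_def by (rule sum_splittings_divisors)
  finally show ?thesis
    using convolution_chi3[OF assms] assms by (simp add: g_def sigma_of_nat)
qed

section \<open>The octonary forms\<close>

text \<open>Both ways of writing the convolution of \<open>h(l/k)\<close> with \<open>g(m)\<close>: the factor \<open>k\<close> can sit in the argument
  or in the coefficient of \<open>l\<close>.\<close>

lemma sum_splittings_dilate_left:
  assumes "k > 0" and fin: "finite (splittings c d n)"
  shows "(\<Sum>(l, m) \<in> splittings c d n. (if k dvd l then h (l div k) else 0) * g m) =
    (\<Sum>(l, m) \<in> splittings (k * c) d n. h l * (g m :: int))"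
proof -
  have "(\<Sum>(l, m) \<in> splittings c d n. (if k dvd l then h (l div k) else 0) * g m) =
     (\<Sum>p \<in> splittings c d n. if k dvd fst p then h (fst p div k) * g (snd p) else 0)"
    by (rule sum.cong) auto
  also have "\<dots> = (\<Sum>p \<in> {p \<in> splittings c d n. k dvd fst p}. h (fst p div k) * g (snd p))"
    using fin by (rule sum.inter_filter[symmetric])
  also have "\<dots> = (\<Sum>(l, m) \<in> splittings (k * c) d n. h l * g m)"
    by (rule sum.reindex_bij_witness[where i = "\<lambda>(l, m). (k * l, m)" and j = "\<lambda>(l, m). (l div k, m)"])
       (use assms in \<open>auto simp: splittings_def algebra_simps elim!: dvdE\<close>)
  finally show ?thesis .
qed

lemma sum_splittings_dilate_right:
  assumes "k > 0" "finite (splittings d c n)"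
  shows "(\<Sum>(l, m) \<in> splittings c d n. g l * (if k dvd m then h (m div k) else 0)) =
    (\<Sum>(l, m) \<in> splittings c (k * d) n. g l * (h m :: int))"
  using sum_splittings_dilate_left[OF assms, of h g]
  by (subst (1 2) sum_splittings_swap) (simp add: mult.commute)

lemma W_of_nat:
  "int (W c d (of_nat n)) = (\<Sum>(l, m) \<in> splittings c d n. int (sigma (of_nat l)) * int (sigma (of_nat m)))"
proof -
  have "{(l, m). of_nat (c * l + d * m) = (of_nat n :: rat)} = splittings c d n"
    unfolding splittings_def of_nat_eq_iff by simp
  then show ?thesis unfolding W_def by (simp add: case_prod_unfold)
qed

lemma W_third: "W c d (of_nat n / 3) = W (3 * c) (3 * d) (of_nat n)"
proof -
  have "of_nat (c * l + d * m) = (of_nat n / 3 :: rat) \<longleftrightarrow>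
     of_nat (3 * c * l + 3 * d * m) = (of_nat n :: rat)" for l m
    by (auto simp: field_simps)
  then show ?thesis unfolding W_def by simp
qed

lemma R_eq_card_reps:
  "R c d n = card {(z, w). int n = int c * quaternary_form z + int d * quaternary_form w}"
  unfolding R_def
  by (rule bij_betw_same_card[of "\<lambda>(x1, x2, x3, x4, x5, x6, x7, x8).
        (((x1, x2), (x3, x4)), ((x5, x6), (x7, x8)))"],
      rule bij_betw_byWitness[where f' = "\<lambda>(((x1, x2), (x3, x4)), ((x5, x6), (x7, x8))).
        (x1, x2, x3, x4, x5, x6, x7, x8)"])
     (auto simp: quaternary_form_def binary_form_def eis_norm_def add.assoc)

theorem R_formula:
  assumes cd: "c > 0" "d > 0" and n: "n > 0"
  shows "int (R c d n) =
      12 * int (sigma (of_nat n / of_nat c)) - 36 * int (sigma (of_nat n / of_nat (3 * c)))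
    + 12 * int (sigma (of_nat n / of_nat d)) - 36 * int (sigma (of_nat n / of_nat (3 * d)))
    + 144 * int (W c d (of_nat n)) + 1296 * int (W c d (of_nat n / 3))
    - 432 * (int (W (3 * c) d (of_nat n)) + int (W c (3 * d) (of_nat n)))"
proof -
  define s where "s k = int (sigma (of_nat k))" for k :: nat
  define t where "t k = (if 3 dvd k then s (k div 3) else 0)" for k :: nat
  define h where "h k = 12 * s k - 36 * t k" for k
  have t: "int (sigma (of_nat k / 3)) = t k" for k
    using sigma_divide[of 3 k] by (simp add: t_def s_def)
  have s_div: "int (sigma (of_nat n / of_nat k)) = (if k dvd n then s (n div k) else 0)" if "k > 0" for k
    using sigma_divide[OF that] by (simp add: s_def)
  have t_div: "int (sigma (of_nat n / of_nat (3 * k))) = (if k dvd n then t (n div k) else 0)"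
    if "k > 0" for k
  proof -
    have "3 * k dvd n \<longleftrightarrow> k dvd n \<and> 3 dvd n div k"
      using that by (auto elim!: dvdE)
    moreover have "n div (3 * k) = n div k div 3" by (simp add: div_mult2_eq mult.commute)
    ultimately show ?thesis using s_div[of "3 * k"] that by (simp add: t_def)
  qed
  have "int (R c d n) = (\<Sum>(l, m) \<in> splittings c d n.
      int (card (reps quaternary_form l)) * int (card (reps quaternary_form m)))"
    unfolding R_eq_card_reps
    by (subst card_reps_sum)
       (simp_all add: cd quaternary_form_nonneg finite_reps_quaternary_form case_prod_unfold)
  also have "\<dots> = (if c dvd n then h (n div c) else 0) + (if d dvd n then h (n div d) else 0)
     + (\<Sum>(l, m) \<in> splittings c d n. h l * h m)"
    using cd n
    by (intro sum_splittings_expand)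
       (simp_all add: card_reps_quaternary_form_0 card_reps_quaternary_form h_def t, simp_all add: s_def t_def)
  also have "(\<Sum>(l, m) \<in> splittings c d n. h l * h m) =
      144 * (\<Sum>(l, m) \<in> splittings c d n. s l * s m) + 1296 * (\<Sum>(l, m) \<in> splittings c d n. t l * t m)
      - 432 * ((\<Sum>(l, m) \<in> splittings c d n. t l * s m) + (\<Sum>(l, m) \<in> splittings c d n. s l * t m))"
    unfolding h_def case_prod_unfold
    by (simp add: sum_distrib_left algebra_simps flip: sum.distrib sum_subtractf)
  also have "(\<Sum>(l, m) \<in> splittings c d n. s l * s m) = int (W c d (of_nat n))"
    by (simp add: W_of_nat s_def)
  also have "(\<Sum>(l, m) \<in> splittings c d n. t l * s m) = int (W (3 * c) d (of_nat n))"
    unfolding t_def using sum_splittings_dilate_left[where k = 3 and h = s and g = s] cd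
    by (simp add: finite_splittings W_of_nat s_def)
  also have "(\<Sum>(l, m) \<in> splittings c d n. s l * t m) = int (W c (3 * d) (of_nat n))"
    unfolding t_def using sum_splittings_dilate_right[where k = 3 and h = s and g = s] cd
    by (simp add: finite_splittings W_of_nat s_def)
  also have "(\<Sum>(l, m) \<in> splittings c d n. t l * t m) = int (W c d (of_nat n / 3))"
  proof -
    have "(\<Sum>(l, m) \<in> splittings c d n. t l * t m) = (\<Sum>(l, m) \<in> splittings (3 * c) d n. s l * t m)"
      using sum_splittings_dilate_left[where k = 3 and h = s and g = t] cd
      by (simp add: finite_splittings t_def)
    also have "\<dots> = (\<Sum>(l, m) \<in> splittings (3 * c) (3 * d) n. s l * s m)"
      unfolding t_def using sum_splittings_dilate_right[where k = 3 and h = s and g = s] cd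
      by (simp add: finite_splittings)
    finally show ?thesis by (simp add: W_third W_of_nat s_def)
  qed
  finally show ?thesis using cd by (simp add: s_div t_div[simplified] h_def)
qed

lemma mu_pos:
  assumes "Q \<subseteq> P3 \<nu> mho"
  shows "mu Q > 0"
  unfolding mu_def using assms by (intro prod_pos) (auto simp: P3_def dest: prime_gt_0_nat)

theorem theorem4p4:
  fixes \<alpha> \<beta> \<nu> mho n c d :: nat
  assumes "\<alpha> > 0" and "\<beta> > 0" and "gcd \<alpha> \<beta> = 1"
    and "\<alpha> * \<beta> = 2 ^ \<nu> * mho"
    and "\<nu> \<in> {0, 1, 2, 3}"
    and "mho > 0" and "odd mho" and "squarefree mho" and "3 dvd mho"
    and "n > 0"
    and "(c, d) \<in> Omega3 \<nu> mho"
  shows "int (R c d n) =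
      12 * int (sigma (of_nat n / of_nat c)) - 36 * int (sigma (of_nat n / of_nat (3 * c)))
    + 12 * int (sigma (of_nat n / of_nat d)) - 36 * int (sigma (of_nat n / of_nat (3 * d)))
    + 144 * int (W c d (of_nat n)) + 1296 * int (W c d (of_nat n / 3))
    - 432 * (int (W (3 * c) d (of_nat n)) + int (W c (3 * d) (of_nat n)))"
proof -
  from assms have "c > 0" "d > 0" by (auto simp: Omega3_def mu_pos)
  then show ?thesis using \<open>n > 0\<close> by (rule R_formula)
qed

end
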